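(* Let $m$ and $F$ be positive integers such that $m<F$ and $m\nmid F$, and let $S\in\mathscr{R}(F,m)$. Then $X=\{x\in\mathrm{msg}(S)\mid x\notin\Delta(F,m)\}$ is the unique minimal $\mathscr{R}(F,m)$-system of generators of $S$.
   Context: A numerical semigroup is a submonoid $S$ of $(\mathbb{N},+)$ ($\mathbb{N}$ the nonnegative integers) with $\mathbb{N}\setminus S$ finite. Its Frobenius number $\mathrm{F}(S)$ is the largest integer not in $S$, its multiplicity is $\mathrm{m}(S)=\min(S\setminus\{0\})$, and $\mathrm{msg}(S)$ is its unique minimal system of generators. $\mathscr{R}(F,m)$ denotes the set of numerical semigroups $S$ with $\mathrm{F}(S)=F$ and $\mathrm{m}(S)=m$. It is closed under intersection and its minimum with respect to inclusion is $\Delta(F,m)=\langle m\rangle\cup\{n\in\mathbb{N}\mid n\ge F+1\}$, where $\langle m\rangle$ is the set of nonnegative multiples of $m$. A set $X$ is an $\mathscr{R}(F,m)$-set if $X\cap\Delta(F,m)=\emptyset$ and there is $S\in\mathscr{R}(F,m)$ with $X\subseteq S$. For such $X$, $\mathscr{R}(F,m)[X]$ denotes the intersection of all elements of $\mathscr{R}(F,m)$ containing $X$ (it is the smallest element of $\mathscr{R}(F,m)$ containing $X$). If $X$ is an $\mathscr{R}(F,m)$-set and $S=\mathscr{R}(F,m)[X]$, then $X$ is called an $\mathscr{R}(F,m)$-system of generators of $S$; it is minimal if moreover $S\neq\mathscr{R}(F,m)[Y]$ for all $Y\subsetneq X$. *)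

theory Defs
  imports Main "HOL.Hull"
begin

definition add_submonoid :: "nat set \<Rightarrow> bool" where
  "add_submonoid S \<longleftrightarrow> 0 \<in> S \<and> (\<forall>x\<in>S. \<forall>y\<in>S. x + y \<in> S)"

definition numerical_semigroup :: "nat set \<Rightarrow> bool" where
  "numerical_semigroup S \<longleftrightarrow> add_submonoid S \<and> finite (UNIV - S)"

(* Integer-valued: every negative integer is outside S, so the value for S = UNIV is -1. *)
definition frobenius_number :: "nat set \<Rightarrow> int" where
  "frobenius_number S = (GREATEST z. z \<notin> int ` S)"

definition multiplicity_of :: "nat set \<Rightarrow> nat" where
  "multiplicity_of S = (LEAST n. n \<in> S - {0})"

definition minimal_generators :: "nat set \<Rightarrow> nat set \<Rightarrow> bool" where
  "minimal_generators S A \<longleftrightarrow>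
     add_submonoid hull A = S \<and> (\<forall>B. B \<subset> A \<longrightarrow> add_submonoid hull B \<noteq> S)"

definition msg :: "nat set \<Rightarrow> nat set" where
  "msg S = (THE A. minimal_generators S A)"

definition semigroups_FM :: "nat \<Rightarrow> nat \<Rightarrow> nat set set" where
  "semigroups_FM F m =
     {S. numerical_semigroup S \<and> frobenius_number S = int F \<and> multiplicity_of S = m}"

definition Delta :: "nat \<Rightarrow> nat \<Rightarrow> nat set" where
  "Delta F m = {k * m | k. True} \<union> {n. n \<ge> F + 1}"

definition FM_set :: "nat \<Rightarrow> nat \<Rightarrow> nat set \<Rightarrow> bool" where
  "FM_set F m X \<longleftrightarrow> X \<inter> Delta F m = {} \<and> (\<exists>S\<in>semigroups_FM F m. X \<subseteq> S)"

definition FM_closure :: "nat \<Rightarrow> nat \<Rightarrow> nat set \<Rightarrow> nat set" where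
  "FM_closure F m X = \<Inter> {S \<in> semigroups_FM F m. X \<subseteq> S}"

definition FM_generators :: "nat \<Rightarrow> nat \<Rightarrow> nat set \<Rightarrow> nat set \<Rightarrow> bool" where
  "FM_generators F m S X \<longleftrightarrow> FM_set F m X \<and> S = FM_closure F m X"

definition minimal_FM_generators :: "nat \<Rightarrow> nat \<Rightarrow> nat set \<Rightarrow> nat set \<Rightarrow> bool" where
  "minimal_FM_generators F m S X \<longleftrightarrow>
     FM_generators F m S X \<and> (\<forall>Y. Y \<subset> X \<longrightarrow> S \<noteq> FM_closure F m Y)"

end

theory Submission
  imports Defs
begin

text \<open>
  The minimal generators of a submonoid \<open>S\<close> of the natural numbers are its irreducible elements:
  the nonzero elements that are not a sum of two nonzero elements of \<open>S\<close>.  They generate \<open>S\<close> by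
  descent, and each of them lies in every generating set, because removing an irreducible element
  from \<open>S\<close> leaves a submonoid.

  The same two observations work inside the family of semigroups with Frobenius number \<open>F\<close> and
  multiplicity \<open>m\<close>.  A member of the family containing the irreducible elements outside \<open>Delta F m\<close>
  contains all irreducible elements, since it contains \<open>Delta F m\<close> anyway, and hence contains \<open>S\<close>
  (\<open>FM_closure_irreducibles\<close>).  Conversely, an irreducible element \<open>x\<close> outside \<open>Delta F m\<close> is
  at most \<open>F\<close> and different from \<open>m\<close>, so that removing it from \<open>S\<close> changes neither invariant
  (\<open>semigroups_FM_remove\<close>); a set omitting \<open>x\<close> therefore generates at most \<open>S - {x}\<close>.  Thus these
  elements form a system of generators contained in every other one, and a least system of
  generators is the only minimal one.
\<close>

section \<open>Irreducible elements of a submonoid\<close>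

definition irreducibles :: "nat set \<Rightarrow> nat set" where
  "irreducibles S = {x \<in> S. x \<noteq> 0 \<and> (\<forall>a\<in>S. \<forall>b\<in>S. a \<noteq> 0 \<longrightarrow> b \<noteq> 0 \<longrightarrow> x \<noteq> a + b)}"

lemma add_submonoid_hull: "add_submonoid (add_submonoid hull A)"
  by (rule hull_in) (auto simp: add_submonoid_def)

lemma irreducibles_subset: "irreducibles S \<subseteq> S"
  by (auto simp: irreducibles_def)

lemma add_submonoid_remove_irreducible:
  assumes "add_submonoid S" "x \<in> irreducibles S"
  shows "add_submonoid (S - {x})"
  unfolding add_submonoid_def
proof (intro conjI ballI)
  show "0 \<in> S - {x}"
    using assms by (auto simp: add_submonoid_def irreducibles_def)
next
  fix a b
  assume ab: "a \<in> S - {x}" "b \<in> S - {x}"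
  then have "a + b \<in> S"
    using assms(1) by (auto simp: add_submonoid_def)
  moreover have "a + b \<noteq> x"
    using ab assms(2) by (cases "a = 0 \<or> b = 0") (auto simp: irreducibles_def)
  ultimately show "a + b \<in> S - {x}"
    by simp
qed

text \<open>A nonzero element that is not irreducible splits into two smaller elements of \<open>S\<close>; this
  descent ends at irreducible elements.\<close>

lemma submonoid_containing_irreducibles:
  assumes "add_submonoid T" "irreducibles S \<subseteq> T"
  shows "S \<subseteq> T"
proof
  fix x
  assume "x \<in> S"
  then show "x \<in> T"
  proof (induction x rule: less_induct)
    case (less x)
    consider "x = 0" | "x \<in> irreducibles S"
      | a b where "a \<in> S" "b \<in> S" "a \<noteq> 0" "b \<noteq> 0" "x = a + b"
      using less.prems by (auto simp: irreducibles_def)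
    then show ?case
    proof cases
      case 3
      then have "a \<in> T" "b \<in> T"
        using less.IH by auto
      then show ?thesis
        using 3 assms(1) by (auto simp: add_submonoid_def)
    qed (use assms in \<open>auto simp: add_submonoid_def\<close>)
  qed
qed

lemma hull_irreducibles:
  assumes "add_submonoid S"
  shows "add_submonoid hull irreducibles S = S"
proof
  show "add_submonoid hull irreducibles S \<subseteq> S"
    by (rule hull_minimal) (use assms irreducibles_subset in auto)
  show "S \<subseteq> add_submonoid hull irreducibles S"
    by (rule submonoid_containing_irreducibles[OF add_submonoid_hull hull_subset])
qed

text \<open>A generating set omitting the irreducible element \<open>x\<close> lies in the submonoid \<open>S - {x}\<close>, and so
  does everything that it generates.\<close>

lemma irreducibles_subset_generators:
  assumes "add_submonoid S" "add_submonoid hull A = S"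
  shows "irreducibles S \<subseteq> A"
proof
  fix x
  assume x: "x \<in> irreducibles S"
  show "x \<in> A"
  proof (rule ccontr)
    assume "x \<notin> A"
    then have "A \<subseteq> S - {x}"
      using assms(2) hull_subset[of A add_submonoid] by auto
    then have "S \<subseteq> S - {x}"
      using hull_minimal add_submonoid_remove_irreducible[OF assms(1) x] assms(2) by metis
    then show False
      using x irreducibles_subset by auto
  qed
qed

lemma msg_eq_irreducibles:
  assumes "add_submonoid S"
  shows "msg S = irreducibles S"
  unfolding msg_def
proof (rule the_equality)
  show "minimal_generators S (irreducibles S)"
    unfolding minimal_generators_def
    using hull_irreducibles[OF assms] irreducibles_subset_generators[OF assms] by blast
next
  fix A
  assume "minimal_generators S A"
  then show "A = irreducibles S"
    unfolding minimal_generators_def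
    using hull_irreducibles[OF assms] irreducibles_subset_generators[OF assms] by blast
qed

section \<open>Semigroups with given Frobenius number and multiplicity\<close>

lemma frobenius_number_eq_iff:
  assumes "finite (UNIV - S)"
  shows "frobenius_number S = int F \<longleftrightarrow> F \<notin> S \<and> (\<forall>n>F. n \<in> S)"
proof
  assume frob: "frobenius_number S = int F"
  \<comment> \<open>Adjoining \<open>-1\<close> makes the maximum exist and be correct also when \<open>S\<close> has no gaps.\<close>
  define M where "M = Max (insert (- 1) (int ` (UNIV - S)))"
  have fin: "finite (insert (- 1) (int ` (UNIV - S)))"
    using assms by simp
  have "M \<in> insert (- 1) (int ` (UNIV - S))"
    unfolding M_def by (rule Max_in) (use fin in auto)
  then have M_gap: "M \<notin> int ` S"
    by auto
  have M_upper: "z \<le> M" if "z \<notin> int ` S" for z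
  proof (cases "z \<ge> 0")
    case True
    then obtain n where "z = int n"
      using nonneg_int_cases by blast
    with that have "z \<in> int ` (UNIV - S)"
      by auto
    then show ?thesis
      unfolding M_def using fin by (intro Max_ge) auto
  next
    case False
    moreover have "- 1 \<le> M"
      unfolding M_def using fin by (intro Max_ge) auto
    ultimately show ?thesis
      by simp
  qed
  have "frobenius_number S = M"
    unfolding frobenius_number_def using M_gap M_upper by (intro Greatest_equality)
  then have M: "M = int F"
    using frob by simp
  have "n \<in> S" if "n > F" for n
  proof (rule ccontr)
    assume "n \<notin> S"
    then have "int n \<notin> int ` S"
      by auto
    then show False
      using M_upper[of "int n"] M that by simp
  qed
  then show "F \<notin> S \<and> (\<forall>n>F. n \<in> S)"
    using M_gap M by auto
next
  assume F: "F \<notin> S \<and> (\<forall>n>F. n \<in> S)"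
  show "frobenius_number S = int F"
    unfolding frobenius_number_def
  proof (rule Greatest_equality)
    show "int F \<notin> int ` S"
      using F by auto
  next
    fix z
    assume z: "z \<notin> int ` S"
    show "z \<le> int F"
    proof (rule ccontr)
      assume "\<not> z \<le> int F"
      then obtain n where "z = int n" "n > F"
        by (cases z) auto
      then show False
        using z F by auto
    qed
  qed
qed

lemma multiplicity_of_eq_iff:
  assumes "S - {0} \<noteq> {}"
  shows "multiplicity_of S = m \<longleftrightarrow> m \<in> S - {0} \<and> (\<forall>n\<in>S - {0}. m \<le> n)"
proof
  assume "multiplicity_of S = m"
  then show "m \<in> S - {0} \<and> (\<forall>n\<in>S - {0}. m \<le> n)"
    unfolding multiplicity_of_def
    using assms LeastI_ex[of "\<lambda>n. n \<in> S - {0}"] Least_le[of "\<lambda>n. n \<in> S - {0}"] by blast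
next
  assume "m \<in> S - {0} \<and> (\<forall>n\<in>S - {0}. m \<le> n)"
  then show "multiplicity_of S = m"
    unfolding multiplicity_of_def by (intro Least_equality) auto
qed

text \<open>Cofiniteness is absorbed by the condition that everything above \<open>F\<close> belongs to \<open>S\<close>, so that
  membership becomes a first-order condition that is easy to check for \<open>S - {x}\<close>.\<close>

lemma semigroups_FM_iff:
  "S \<in> semigroups_FM F m \<longleftrightarrow>
     add_submonoid S \<and> F \<notin> S \<and> (\<forall>n>F. n \<in> S) \<and> m \<in> S - {0} \<and> (\<forall>n\<in>S - {0}. m \<le> n)"
  (is "?L \<longleftrightarrow> ?R")
proof -
  have fin: "finite (UNIV - S)" if "\<forall>n>F. n \<in> S"
  proof (rule finite_subset)
    show "UNIV - S \<subseteq> {..F}"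
      using that not_le by blast
  qed simp
  have nonzero: "S - {0} \<noteq> {}" if "\<forall>n>F. n \<in> S"
    using that lessI[of F] by blast
  show ?thesis
    unfolding semigroups_FM_def numerical_semigroup_def
    using fin nonzero frobenius_number_eq_iff[of S F] multiplicity_of_eq_iff[of S m] by blast
qed

section \<open>Generation within the family\<close>

lemma Delta_subset:
  assumes "S \<in> semigroups_FM F m"
  shows "Delta F m \<subseteq> S"
proof -
  have S: "add_submonoid S" "m \<in> S" "\<forall>n>F. n \<in> S"
    using assms by (auto simp: semigroups_FM_iff)
  have "k * m \<in> S" for k
    by (induction k) (use S in \<open>auto simp: add_submonoid_def\<close>)
  then show ?thesis
    using S(3) by (auto simp: Delta_def)
qed

text \<open>Lying outside \<open>Delta F m\<close> is what protects the invariants: \<open>m\<close> and all numbers above \<open>F\<close>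
  stay in the semigroup.\<close>

lemma semigroups_FM_remove:
  assumes "S \<in> semigroups_FM F m" "x \<in> irreducibles S" "x \<notin> Delta F m"
  shows "S - {x} \<in> semigroups_FM F m"
proof -
  have "x \<noteq> m"
    using assms(3) by (auto simp: Delta_def intro: exI[of _ 1])
  moreover have "x \<le> F"
    using assms(3) by (auto simp: Delta_def)
  ultimately show ?thesis
    using assms(1) add_submonoid_remove_irreducible[OF _ assms(2)]
    by (auto simp: semigroups_FM_iff)
qed

text \<open>Every member of the family contains \<open>Delta F m\<close>, so discarding the irreducible elements in
  it loses nothing.\<close>

lemma FM_closure_irreducibles:
  assumes "S \<in> semigroups_FM F m"
  shows "FM_closure F m (irreducibles S - Delta F m) = S"
proof
  show "FM_closure F m (irreducibles S - Delta F m) \<subseteq> S"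
    unfolding FM_closure_def using assms irreducibles_subset by blast
next
  have "S \<subseteq> T" if "T \<in> semigroups_FM F m" "irreducibles S - Delta F m \<subseteq> T" for T
  proof (rule submonoid_containing_irreducibles)
    show "add_submonoid T"
      using that(1) by (simp add: semigroups_FM_iff)
    show "irreducibles S \<subseteq> T"
      using that(2) Delta_subset[OF that(1)] by blast
  qed
  then show "S \<subseteq> FM_closure F m (irreducibles S - Delta F m)"
    unfolding FM_closure_def by blast
qed

lemma irreducibles_subset_FM_generators:
  assumes "S \<in> semigroups_FM F m" "FM_closure F m Y = S"
  shows "irreducibles S - Delta F m \<subseteq> Y"
proof
  fix x
  assume x: "x \<in> irreducibles S - Delta F m"
  show "x \<in> Y"
  proof (rule ccontr)
    assume "x \<notin> Y"
    moreover have "Y \<subseteq> S"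
      using assms(2) unfolding FM_closure_def by blast
    ultimately have "Y \<subseteq> S - {x}"
      by blast
    moreover have "S - {x} \<in> semigroups_FM F m"
      using semigroups_FM_remove[OF assms(1)] x by blast
    ultimately have "S \<subseteq> S - {x}"
      using assms(2) unfolding FM_closure_def by blast
    then show False
      using x irreducibles_subset by auto
  qed
qed

theorem proposition5p4:
  fixes m F :: nat and S X :: "nat set"
  assumes "m > 0" and "F > 0" and "m < F" and "\<not> m dvd F"
    and "S \<in> semigroups_FM F m"
    and "X = {x \<in> msg S. x \<notin> Delta F m}"
  shows "minimal_FM_generators F m S X \<and> (\<forall>Y. minimal_FM_generators F m S Y \<longrightarrow> Y = X)"
proof -
  have "add_submonoid S"
    using assms(5) by (simp add: semigroups_FM_iff)
  then have X: "X = irreducibles S - Delta F m"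
    using assms(6) msg_eq_irreducibles by auto
  have closure: "FM_closure F m X = S"
    using FM_closure_irreducibles[OF assms(5)] X by simp
  have least: "X \<subseteq> Y" if "S = FM_closure F m Y" for Y
    using irreducibles_subset_FM_generators[OF assms(5)] that X by simp
  have "FM_set F m X"
    unfolding FM_set_def using assms(5) X irreducibles_subset by blast
  then have "minimal_FM_generators F m S X"
    unfolding minimal_FM_generators_def FM_generators_def using closure least by blast
  moreover have "Y = X" if "minimal_FM_generators F m S Y" for Y
    using that closure least unfolding minimal_FM_generators_def FM_generators_def by blast
  ultimately show ?thesis
    by blast
qed

end
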